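(* Let $T$ be an up or down rule on an $I$-graded poset $\Omega$. Suppose there is a sequence $(\hat{b}_i\in\ell_1(\Omega_i))_{i\in I}$ such that for any $m\le n$ in $I$ there exists a $T$-sequence $(\pi_i)_{i\in[m,n]}$ with $\pi_i\le\hat{b}_i$ for any $i\in[m,n]$. Then there exists a maximal $T$-sequence, i.e. a $T$-sequence $(\pi_i)_{i\in I}$ with index interval $I$.
   Context: Let $I\subseteq\mathbb{Z}$ be a (possibly infinite) nonempty interval of integers. An $I$-graded poset $\Omega$ is a countable (or finite) poset with a surjective map $\rho\colon\Omega\to I$ (the rank function) such that $u<v$ implies $\rho(u)<\rho(v)$, and $u\lessdot v$ implies $\rho(v)=\rho(u)+1$. Here $u\lessdot v$ means that $v$ covers $u$. The level sets are $\Omega_i=\rho^{-1}(i)$. An up rule on $\Omega$ is an assignment of a probability $T(u\rightarrow v)\in[0,1]$ to each pair $(u,v)\in\Omega\times\Omega$ such that $T(u\rightarrow v)>0\Leftrightarrow u\lessdot v$, and $\sum_{v\in\Omega}T(u\rightarrow v)=1$ for every $u$ of non-maximal rank. A down rule is such an assignment with $T(u\rightarrow v)>0\Leftrightarrow v\lessdot u$, and $\sum_{v\in\Omega}T(u\rightarrow v)=1$ for every $u$ of non-minimal rank. $\ell_1(\Omega)$ is the Banach space of functions $f\colon\Omega\to\mathbb{R}$ with $\|f\|=\sum_{u}|f(u)|<\infty$. $\ell_1(\Omega_i)$ is the subspace of functions vanishing outside $\Omega_i$. $M(\Omega_i)$ is the set of $\pi\in\ell_1(\Omega_i)$ that are nonnegative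 with $\sum_{u\in\Omega_i}\pi(u)=1$. For $f,g\in\ell_1(\Omega)$, $f\le g$ means $f(u)\le g(u)$ for all $u\in\Omega$. $T$ induces a linear operator on $\ell_1(\Omega)$ by $(T\pi)(v)=\sum_{u\in\Omega}T(u\rightarrow v)\pi(u)$. For an interval $J\subseteq I$, a sequence $(\pi_i\in M(\Omega_i))_{i\in J}$ is a $T$-sequence if, when $T$ is an up rule, $T\pi_i=\pi_{i+1}$ for every non-maximal $i\in J$, and, when $T$ is a down rule, $T\pi_i=\pi_{i-1}$ for every non-minimal $i\in J$. *)

theory Defs
  imports "HOL-Analysis.Analysis"
begin

text \<open>The poset is the whole of a countable type of class \<open>order\<close>; it is automatically nonempty,
  in agreement with the rank function being onto a nonempty interval.\<close>

definition int_interval :: "int set \<Rightarrow> bool" where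
  "int_interval J \<longleftrightarrow> (\<forall>a\<in>J. \<forall>b\<in>J. {a..b} \<subseteq> J)"

definition covered_by :: "'a::order \<Rightarrow> 'a \<Rightarrow> bool"  (infix "\<lessdot>" 50) where
  "u \<lessdot> v \<longleftrightarrow> u < v \<and> (\<nexists>w. u < w \<and> w < v)"

definition graded_poset :: "int set \<Rightarrow> ('a::{order,countable} \<Rightarrow> int) \<Rightarrow> bool" where
  "graded_poset I \<rho> \<longleftrightarrow> I \<noteq> {} \<and> int_interval I \<and> range \<rho> = I \<and>
     (\<forall>u v. u < v \<longrightarrow> \<rho> u < \<rho> v) \<and> (\<forall>u v. u \<lessdot> v \<longrightarrow> \<rho> v = \<rho> u + 1)"

definition up_rule ::
    "int set \<Rightarrow> ('a::{order,countable} \<Rightarrow> int) \<Rightarrow> ('a \<Rightarrow> 'a \<Rightarrow> real) \<Rightarrow> bool" where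
  "up_rule I \<rho> T \<longleftrightarrow> (\<forall>u v. T u v \<in> {0..1}) \<and> (\<forall>u v. T u v > 0 \<longleftrightarrow> u \<lessdot> v) \<and>
     (\<forall>u. (\<exists>j\<in>I. \<rho> u < j) \<longrightarrow> ((\<lambda>v. T u v) has_sum 1) UNIV)"

definition down_rule ::
    "int set \<Rightarrow> ('a::{order,countable} \<Rightarrow> int) \<Rightarrow> ('a \<Rightarrow> 'a \<Rightarrow> real) \<Rightarrow> bool" where
  "down_rule I \<rho> T \<longleftrightarrow> (\<forall>u v. T u v \<in> {0..1}) \<and> (\<forall>u v. T u v > 0 \<longleftrightarrow> v \<lessdot> u) \<and>
     (\<forall>u. (\<exists>j\<in>I. j < \<rho> u) \<longrightarrow> ((\<lambda>v. T u v) has_sum 1) UNIV)"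

definition ell1_level :: "('a \<Rightarrow> int) \<Rightarrow> int \<Rightarrow> ('a \<Rightarrow> real) set" where
  "ell1_level \<rho> i = {f. (\<lambda>u. \<bar>f u\<bar>) summable_on UNIV \<and> (\<forall>u. \<rho> u \<noteq> i \<longrightarrow> f u = 0)}"

definition prob_level :: "('a \<Rightarrow> int) \<Rightarrow> int \<Rightarrow> ('a \<Rightarrow> real) set" where
  "prob_level \<rho> i = {p \<in> ell1_level \<rho> i. (\<forall>u. 0 \<le> p u) \<and> (p has_sum 1) {u. \<rho> u = i}}"

text \<open>The sum converges absolutely when \<open>T\<close> takes values in \<open>[0,1]\<close> and \<open>p\<close> is absolutely summable,
  the only case in which \<open>rule_op\<close> is used.\<close>

definition rule_op :: "('a \<Rightarrow> 'a \<Rightarrow> real) \<Rightarrow> ('a \<Rightarrow> real) \<Rightarrow> 'a \<Rightarrow> real" where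
  "rule_op T p v = (\<Sum>\<^sub>\<infinity>u. T u v * p u)"

text \<open>\<open>p i\<close> is irrelevant for \<open>i \<notin> J\<close>. A rule can be both an up and a down rule only if \<open>I\<close> is a
  singleton, and then both implications below are vacuous.\<close>

definition T_sequence ::
    "int set \<Rightarrow> ('a::{order,countable} \<Rightarrow> int) \<Rightarrow> ('a \<Rightarrow> 'a \<Rightarrow> real) \<Rightarrow> int set \<Rightarrow>
     (int \<Rightarrow> 'a \<Rightarrow> real) \<Rightarrow> bool" where
  "T_sequence I \<rho> T J p \<longleftrightarrow> int_interval J \<and> J \<subseteq> I \<and> (\<forall>i\<in>J. p i \<in> prob_level \<rho> i) \<and>
     (up_rule I \<rho> T \<longrightarrow> (\<forall>i\<in>J. (\<exists>j\<in>J. i < j) \<longrightarrow> rule_op T (p i) = p (i + 1))) \<and>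
     (down_rule I \<rho> T \<longrightarrow> (\<forall>i\<in>J. (\<exists>j\<in>J. j < i) \<longrightarrow> rule_op T (p i) = p (i - 1)))"

end

theory Submission
  imports Defs
begin

text \<open>
  The argument is compactness. The interval \<open>I\<close> is exhausted by finite intervals \<open>[m k, n k]\<close>, each
  of which carries a \<open>T\<close>-sequence below \<open>b\<close>. Extended by zero, these \<open>T\<close>-sequences are functions
  on the countable set of pairs of an index and a poset element, and they lie in a product of
  compact intervals, with bounds given by \<open>\<bar>b\<bar>\<close>. A subsequence therefore converges pointwise
  (\<open>pointwise_convergent_subsequence\<close>).

  Mass can escape in a pointwise limit of probability distributions, and then the limit has total
  mass below one, and applying \<open>T\<close> need not commute with the limit: both involve infinite sums over
  a level. This is where the summability of \<open>b i\<close> enters. By dominated convergence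
  (\<open>tendsto_infsum_dominated\<close>) all these sums pass to the limit, which gives
  \<open>prob_level_limit\<close> and \<open>rule_op_tendsto\<close>. Each index and its neighbour eventually lie in
  \<open>[m k, n k]\<close>, so the limit satisfies every condition of a \<open>T\<close>-sequence on \<open>I\<close>.
\<close>

lemma pointwise_convergent_subsequence:
  fixes q :: "nat \<Rightarrow> 'c::countable \<Rightarrow> real"
  assumes bound: "\<And>k x. \<bar>q k x\<bar> \<le> B x"
  obtains r l where "strict_mono (r :: nat \<Rightarrow> nat)" "\<And>x. (\<lambda>k. q (r k) x) \<longlonglongrightarrow> l x"
proof -
  \<comment> \<open>Tychonoff gives compactness of the box; since the index set is countable, the product is
    first countable, and compactness yields convergent subsequences.\<close>
  let ?K = "Pi\<^sub>E UNIV (\<lambda>x. {- B x..B x})"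
  have "compactin (product_topology (\<lambda>_. euclidean) UNIV) ?K"
    unfolding compactin_PiE by auto
  hence "compact ?K"
    by (simp add: euclidean_product_topology)
  hence "seq_compact ?K"
    by (rule compact_imp_seq_compact)
  moreover have "\<forall>k. q k \<in> ?K"
    using bound by (auto simp: PiE_def Pi_def abs_le_iff minus_le_iff)
  ultimately obtain l r where r: "strict_mono (r :: nat \<Rightarrow> nat)" and lim: "(q \<circ> r) \<longlonglongrightarrow> l"
    unfolding seq_compact_def by blast
  have "(\<lambda>k. q (r k) x) \<longlonglongrightarrow> l x" for x
  proof -
    have "continuous_on UNIV (\<lambda>f :: 'c \<Rightarrow> real. f x)"
      by (rule continuous_on_product_coordinates)
    hence "isCont (\<lambda>f :: 'c \<Rightarrow> real. f x) l"
      using continuous_on_eq_continuous_at[OF open_UNIV] by blast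
    thus ?thesis
      using isCont_tendsto_compose[OF _ lim] by (fastforce simp: comp_def)
  qed
  with r show thesis
    by (rule that)
qed

lemma tendsto_infsum_dominated:
  fixes f :: "nat \<Rightarrow> 'a \<Rightarrow> real"
  assumes lim: "\<And>x. (\<lambda>k. f k x) \<longlonglongrightarrow> g x"
    and bound: "\<And>k x. \<bar>f k x\<bar> \<le> B x"
    and B: "B summable_on UNIV"
  shows "(\<lambda>x. \<bar>g x\<bar>) summable_on UNIV"
    and "(\<lambda>k. \<Sum>\<^sub>\<infinity>x. f k x) \<longlonglongrightarrow> (\<Sum>\<^sub>\<infinity>x. g x)"
proof -
  have B0: "0 \<le> B x" for x
    using bound[of 0 x] by linarith
  have gB: "\<bar>g x\<bar> \<le> B x" for x
    by (rule LIMSEQ_le_const2[OF tendsto_rabs[OF lim]]) (use bound in blast)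
  show sg: "(\<lambda>x. \<bar>g x\<bar>) summable_on UNIV"
    by (rule summable_on_comparison_test[OF B]) (use gB in auto)
  have sf: "(\<lambda>x. \<bar>f k x\<bar>) summable_on UNIV" for k
    by (rule summable_on_comparison_test[OF B]) (use bound in auto)
  \<comment> \<open>Absolutely convergent sums are integrals for the counting measure, so that Lebesgue's
    dominated convergence theorem applies.\<close>
  have "(\<lambda>x. norm (B x)) summable_on UNIV"
    using B B0 by simp
  hence "integrable (count_space UNIV) B"
    using abs_summable_equivalent abs_summable_on_def by blast
  hence "(\<lambda>k. \<integral>x. f k x \<partial>count_space UNIV) \<longlonglongrightarrow> (\<integral>x. g x \<partial>count_space UNIV)"
    by (intro integral_dominated_convergence[where w = B]) (use lim bound in auto)
  moreover have "(\<integral>x. h x \<partial>count_space UNIV) = (\<Sum>\<^sub>\<infinity>x. h x)"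
    if "(\<lambda>x. \<bar>h x\<bar>) summable_on UNIV" for h :: "'a \<Rightarrow> real"
    using infsetsum_infsum[of h UNIV] abs_summable_equivalent[of h UNIV] that
    by (simp add: infsetsum_def)
  ultimately show "(\<lambda>k. \<Sum>\<^sub>\<infinity>x. f k x) \<longlonglongrightarrow> (\<Sum>\<^sub>\<infinity>x. g x)"
    using sf sg by simp
qed

lemma has_sum_level_iff_UNIV:
  assumes "\<And>u. \<rho> u \<noteq> i \<Longrightarrow> p u = 0"
  shows "(p has_sum s) {u. \<rho> u = i} \<longleftrightarrow> (p has_sum s) UNIV"
  by (rule has_sum_cong_neutral) (use assms in auto)

text \<open>No mass escapes in the limit, because the distributions have a common summable bound.\<close>

lemma prob_level_limit:
  fixes q :: "nat \<Rightarrow> 'a \<Rightarrow> real"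
  assumes lim: "\<And>u. (\<lambda>k. q k u) \<longlonglongrightarrow> p u"
    and bound: "\<And>k u. \<bar>q k u\<bar> \<le> B u"
    and B: "B summable_on UNIV"
    and ev: "\<forall>\<^sub>F k in sequentially. q k \<in> prob_level \<rho> i"
  shows "p \<in> prob_level \<rho> i"
proof -
  note dom = tendsto_infsum_dominated[OF lim bound B]
  have vanish: "p u = 0" if "\<rho> u \<noteq> i" for u
  proof -
    have "\<forall>\<^sub>F k in sequentially. q k u = 0"
      using ev by eventually_elim (use that in \<open>auto simp: prob_level_def ell1_level_def\<close>)
    thus ?thesis
      using LIMSEQ_unique[OF lim tendsto_eventually] by simp
  qed
  have nonneg: "0 \<le> p u" for u
  proof (rule tendsto_lowerbound[OF lim])
    show "\<forall>\<^sub>F k in sequentially. 0 \<le> q k u"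
      using ev by eventually_elim (auto simp: prob_level_def)
  qed simp
  have "\<forall>\<^sub>F k in sequentially. (\<Sum>\<^sub>\<infinity>u. q k u) = 1"
    using ev
  proof eventually_elim
    case (elim k)
    hence "(q k has_sum 1) UNIV"
      using has_sum_level_iff_UNIV[of \<rho> i "q k"] by (auto simp: prob_level_def ell1_level_def)
    thus ?case
      by (rule infsumI)
  qed
  hence "(\<Sum>\<^sub>\<infinity>u. p u) = 1"
    using LIMSEQ_unique[OF dom(2) tendsto_eventually] by simp
  moreover have "p summable_on UNIV"
    using dom(1) by (simp add: abs_summable_summable)
  ultimately have "(p has_sum 1) UNIV"
    by (metis has_sum_infsum)
  hence "(p has_sum 1) {u. \<rho> u = i}"
    using has_sum_level_iff_UNIV[of \<rho> i p] vanish by blast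
  thus ?thesis
    using dom(1) vanish nonneg by (simp add: prob_level_def ell1_level_def)
qed

lemma rule_op_tendsto:
  fixes q :: "nat \<Rightarrow> 'a \<Rightarrow> real"
  assumes lim: "\<And>u. (\<lambda>k. q k u) \<longlonglongrightarrow> p u"
    and bound: "\<And>k u. \<bar>q k u\<bar> \<le> B u"
    and B: "B summable_on UNIV"
    and T: "\<And>u v. T u v \<in> {0..1}"
  shows "(\<lambda>k. rule_op T (q k) v) \<longlonglongrightarrow> rule_op T p v"
  unfolding rule_op_def
proof (rule tendsto_infsum_dominated(2)[OF _ _ B])
  show "(\<lambda>k. T u v * q k u) \<longlonglongrightarrow> T u v * p u" for u
    by (intro tendsto_intros lim)
  show "\<bar>T u v * q k u\<bar> \<le> B u" for k u
  proof -
    have "\<bar>T u v * q k u\<bar> \<le> 1 * \<bar>q k u\<bar>"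
      unfolding abs_mult by (rule mult_right_mono) (use T[of u v] in auto)
    thus ?thesis
      using bound[of k u] by linarith
  qed
qed

lemma exhaust_by_intervals:
  fixes I :: "int set"
  assumes "I \<noteq> {}"
  obtains m n :: "nat \<Rightarrow> int"
  where "\<And>k. m k \<in> I" "\<And>k. n k \<in> I" "\<And>k. m k \<le> n k"
    and "\<And>i. i \<in> I \<Longrightarrow> \<forall>\<^sub>F k in sequentially. i \<in> {m k..n k}"
proof -
  obtain a where a: "a \<in> I"
    using assms by blast
  define S where "S k = I \<inter> {a - int k..a + int k}" for k
  have fin: "finite (S k)" and ne: "S k \<noteq> {}" for k
    using a by (auto simp: S_def)
  show thesis
  proof (rule that[of "\<lambda>k. Min (S k)" "\<lambda>k. Max (S k)"])
    show "Min (S k) \<in> I" for k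
      using Min_in[OF fin ne, of k] by (simp add: S_def)
    show "Max (S k) \<in> I" for k
      using Max_in[OF fin ne, of k] by (simp add: S_def)
    show "Min (S k) \<le> Max (S k)" for k
      using Min_le[OF fin Max_in[OF fin ne]] .
    show "\<forall>\<^sub>F k in sequentially. i \<in> {Min (S k)..Max (S k)}" if "i \<in> I" for i
      using eventually_ge_at_top[of "nat \<bar>i - a\<bar>"]
    proof eventually_elim
      case (elim k)
      hence "i \<in> S k"
        using that by (auto simp: S_def)
      thus ?case
        using fin by simp
    qed
  qed
qed

theorem theorem4:
  fixes I :: "int set"
    and \<rho> :: "'a::{order,countable} \<Rightarrow> int"
    and T :: "'a \<Rightarrow> 'a \<Rightarrow> real"
    and b :: "int \<Rightarrow> 'a \<Rightarrow> real"
  assumes "graded_poset I \<rho>"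
    and "up_rule I \<rho> T \<or> down_rule I \<rho> T"
    and "\<forall>i\<in>I. b i \<in> ell1_level \<rho> i"
    and "\<forall>m\<in>I. \<forall>n\<in>I. m \<le> n \<longrightarrow>
           (\<exists>p. T_sequence I \<rho> T {m..n} p \<and> (\<forall>i\<in>{m..n}. p i \<le> b i))"
  shows "\<exists>p. T_sequence I \<rho> T I p"
proof -
  have "I \<noteq> {}" and int: "int_interval I"
    using assms(1) by (auto simp: graded_poset_def)
  have T01: "T u v \<in> {0..1}" for u v
    using assms(2) unfolding up_rule_def down_rule_def by blast
  obtain m n :: "nat \<Rightarrow> int"
    where mn: "\<And>k. m k \<in> I" "\<And>k. n k \<in> I" "\<And>k. m k \<le> n k"
      and ex: "\<And>i. i \<in> I \<Longrightarrow> \<forall>\<^sub>F k in sequentially. i \<in> {m k..n k}"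
    using exhaust_by_intervals[OF \<open>I \<noteq> {}\<close>] by blast
  have "\<exists>p. T_sequence I \<rho> T {m k..n k} p \<and> (\<forall>i\<in>{m k..n k}. p i \<le> b i)" for k
    using assms(4) mn by blast
  then obtain P where P: "\<And>k. T_sequence I \<rho> T {m k..n k} (P k)"
    and Pb: "\<And>k i. i \<in> {m k..n k} \<Longrightarrow> P k i \<le> b i"
    by metis
  have Pprob: "P k i \<in> prob_level \<rho> i" if "i \<in> {m k..n k}" for k i
    using P[of k] that by (auto simp: T_sequence_def)

  \<comment> \<open>Extension by zero makes the bound by \<open>\<bar>b\<bar>\<close> hold for every \<open>k\<close>, and not only eventually.\<close>
  define q where "q k x = (if fst x \<in> {m k..n k} then P k (fst x) (snd x) else 0)" for k x
  have qb: "\<bar>q k (i, u)\<bar> \<le> \<bar>b i u\<bar>" for k i u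
  proof (cases "i \<in> {m k..n k}")
    case True
    hence "0 \<le> P k i u" "P k i u \<le> b i u"
      using Pprob[OF True] le_funD[OF Pb[OF True]] by (auto simp: prob_level_def)
    thus ?thesis
      by (auto simp: q_def)
  qed (auto simp: q_def)
  hence qb': "\<bar>q k x\<bar> \<le> \<bar>b (fst x) (snd x)\<bar>" for k x
    by (metis prod.collapse)
  obtain r l where r: "strict_mono r"
    and l: "\<And>x. (\<lambda>k. q (r k) x) \<longlonglongrightarrow> l x"
    by (fact pointwise_convergent_subsequence[of q, OF qb'])

  define p where "p i u = l (i, u)" for i u
  define Q where "Q k i u = q (r k) (i, u)" for k i u
  have lim: "(\<lambda>k. Q k i u) \<longlonglongrightarrow> p i u" for i u
    using l by (simp add: p_def Q_def)
  have Qb: "\<bar>Q k i u\<bar> \<le> \<bar>b i u\<bar>" for k i u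
    using qb by (simp add: Q_def)
  have summ: "(\<lambda>u. \<bar>b i u\<bar>) summable_on UNIV" if "i \<in> I" for i
    using assms(3) that by (auto simp: ell1_level_def)
  have QP: "Q k i = P (r k) i" if "i \<in> {m (r k)..n (r k)}" for k i
    using that by (auto simp: Q_def q_def)
  have ex': "\<forall>\<^sub>F k in sequentially. i \<in> {m (r k)..n (r k)}" if "i \<in> I" for i
    using eventually_compose_filterlim[OF ex[OF that] filterlim_subseq[OF r]] .

  have prob: "p i \<in> prob_level \<rho> i" if "i \<in> I" for i
  proof (rule prob_level_limit[OF lim Qb summ[OF that]])
    show "\<forall>\<^sub>F k in sequentially. Q k i \<in> prob_level \<rho> i"
      using ex'[OF that] by eventually_elim (simp only: QP Pprob)
  qed

  have step: "rule_op T (p i) = p j"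
    if "i \<in> I" "j \<in> I"
      and eq: "\<And>k. i \<in> {m k..n k} \<Longrightarrow> j \<in> {m k..n k} \<Longrightarrow> rule_op T (P k i) = P k j" for i j
  proof
    fix v
    have "\<forall>\<^sub>F k in sequentially. rule_op T (Q k i) v = Q k j v"
      using ex'[OF \<open>i \<in> I\<close>] ex'[OF \<open>j \<in> I\<close>] by eventually_elim (simp only: QP eq)
    moreover have "(\<lambda>k. rule_op T (Q k i) v) \<longlonglongrightarrow> rule_op T (p i) v"
      by (rule rule_op_tendsto[OF lim Qb summ[OF \<open>i \<in> I\<close>] T01])
    ultimately have "(\<lambda>k. Q k j v) \<longlonglongrightarrow> rule_op T (p i) v"
      by (rule Lim_transform_eventually[rotated])
    thus "rule_op T (p i) v = p j v"
      by (rule LIMSEQ_unique[OF _ lim])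
  qed

  have up: "rule_op T (p i) = p (i + 1)" if "up_rule I \<rho> T" "i \<in> I" "j \<in> I" "i < j" for i j
  proof (rule step)
    have "{i..j} \<subseteq> I"
      using int that by (simp add: int_interval_def)
    thus "i + 1 \<in> I"
      using that by auto
    show "rule_op T (P k i) = P k (i + 1)" if "i \<in> {m k..n k}" "i + 1 \<in> {m k..n k}" for k
    proof -
      have "\<exists>j\<in>{m k..n k}. i < j"
        using that by (intro bexI[of _ "i + 1"]) auto
      thus ?thesis
        using P[of k] \<open>up_rule I \<rho> T\<close> that unfolding T_sequence_def by blast
    qed
  qed fact
  have down: "rule_op T (p i) = p (i - 1)" if "down_rule I \<rho> T" "i \<in> I" "j \<in> I" "j < i" for i j
  proof (rule step)
    have "{j..i} \<subseteq> I"
      using int that by (simp add: int_interval_def)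
    thus "i - 1 \<in> I"
      using that by auto
    show "rule_op T (P k i) = P k (i - 1)" if "i \<in> {m k..n k}" "i - 1 \<in> {m k..n k}" for k
    proof -
      have "\<exists>j\<in>{m k..n k}. j < i"
        using that by (intro bexI[of _ "i - 1"]) auto
      thus ?thesis
        using P[of k] \<open>down_rule I \<rho> T\<close> that unfolding T_sequence_def by blast
    qed
  qed fact
  show ?thesis
    unfolding T_sequence_def using int prob up down
    by (intro exI[of _ p] conjI ballI impI subset_refl) blast+
qed

end
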